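(* Let $N,r,d$ be positive integers and let $F_1,\ldots,F_N$ be $N$ families of $r$ points each in $\mathbb{R}^d$, considered as color classes. If $0\in\operatorname{conv}(F_i)$ for each $i$, then we can make a colorful choice $x_1\in F_1,\ldots,x_N\in F_N$ such that for $X=\{x_1,\ldots,x_N\}$ (counted with multiplicity) we have \[ \operatorname{depth}(X,0)\ \ge\ \frac{N}{r}-\sqrt{\frac{dN\ln(Nr)}{2}} . \]
   Context: $\operatorname{conv}$ denotes convex hull. For a finite collection $X$ of points in $\mathbb{R}^d$ and a point $p\in\mathbb{R}^d$, the (Tukey, half-space) depth is \[ \operatorname{depth}(X,p)=\min\{|H\cap X| : p\in H,\ H\text{ a closed half-space}\}. \] For $X=\{x_1,\ldots,x_N\}$ given as an indexed collection, $|H\cap X|$ is the number of indices $i$ with $x_i\in H$. *)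

theory Defs
  imports "HOL-Analysis.Analysis"
begin

definition closed_halfspace :: "'a::euclidean_space set \<Rightarrow> bool" where
  "closed_halfspace H \<longleftrightarrow> (\<exists>a b. a \<noteq> 0 \<and> H = {y. a \<bullet> y \<le> b})"

text \<open>The collection is indexed by a finite set \<open>I\<close>, so points are counted with multiplicity.
  For finite \<open>I\<close> the counts form a finite nonempty set, so the minimum is
  attained.\<close>

definition depth :: "'i set \<Rightarrow> ('i \<Rightarrow> 'a::euclidean_space) \<Rightarrow> 'a \<Rightarrow> nat" where
  "depth I x p = Min {card {i \<in> I. x i \<in> H} | H. closed_halfspace H \<and> p \<in> H}"

end

theory Submission
  imports Defs "HOL-Probability.Hoeffding"
begin

text \<open>
  The choice is made at random. Pick one point from each family independently and uniformly.
  A closed half-space \<open>H\<close> with \<open>0 \<in> H\<close> meets every family, because its complement is convex and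
  does not contain \<open>0\<close>; so each chosen point lies in \<open>H\<close> with probability at least \<open>1 / r\<close>, and
  the expected number of chosen points in \<open>H\<close> is at least \<open>N / r\<close>. By Hoeffding's inequality
  (\<open>prob_few_hits_le\<close>) this number falls short of \<open>N / r\<close> by \<open>t = sqrt (d * N * ln (N * r) / 2)\<close>
  with probability at most \<open>exp (- 2 * t\<^sup>2 / N) = (N * r) powr - d\<close>.

  The half-spaces are infinite in number, but only finitely many matter. A half-space around \<open>0\<close>
  can be replaced by one with \<open>0\<close> on its boundary, and its normal can then be perturbed so that
  the boundary contains no other given point; both changes only remove points
  (\<open>halfspace_contains_trace\<close>). The normals of these generic half-spaces lie in the cells of a
  central hyperplane arrangement, with one hyperplane for each of the at most \<open>M = N * r\<close> nonzero
  points, and such an arrangement has at most \<open>2 * M ^ (d - 1)\<close> cells (\<open>card_traces_le\<close>). This is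
  smaller than \<open>M ^ d\<close> when \<open>M \<ge> 3\<close>, so a union bound leaves a choice that is good for all
  half-spaces at once. For \<open>M \<le> 2\<close> either \<open>r = 1\<close>, where all points are \<open>0\<close>, or the bound to be
  proved is negative.
\<close>

section \<open>Generic half-spaces through the origin\<close>

text \<open>
  An element of \<open>traces V S\<close> is the part of \<open>S\<close> in an open half-space with normal in \<open>V\<close> whose
  boundary avoids \<open>S\<close>. When \<open>0 \<notin> S\<close>, these correspond to the cells that the hyperplanes
  orthogonal to the points of \<open>S\<close> cut out of \<open>V\<close>.
\<close>

definition traces :: "'a::euclidean_space set \<Rightarrow> 'a set \<Rightarrow> 'a set set" where
  "traces V S = {{y \<in> S. a \<bullet> y < 0} | a. a \<in> V \<and> (\<forall>y\<in>S. a \<bullet> y \<noteq> 0)}"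

lemma traces_subset_Pow: "traces V S \<subseteq> Pow S"
  by (auto simp: traces_def)

lemma finite_traces: "finite S \<Longrightarrow> finite (traces V S)"
  by (meson finite_Pow_iff finite_subset traces_subset_Pow)

lemma traces_dim_0:
  assumes "dim V = 0" "S \<noteq> {}"
  shows "traces V S = {}"
  using assms by (auto simp: traces_def)

text \<open>
  Deletion and restriction: after \<open>y\<close> is deleted, a trace is counted twice exactly when it comes
  from normals on both sides of the hyperplane orthogonal to \<open>y\<close>. A positive combination of two
  such normals lies on that hyperplane and has the same trace.
\<close>

lemma card_traces_insert_le:
  assumes "finite S" "y \<notin> S" "subspace V"
  shows "card (traces V (insert y S))
    \<le> card (traces V S) + card (traces (V \<inter> {a. a \<bullet> y = 0}) S)"
proof -
  define P where "P = {A \<in> traces V (insert y S). y \<notin> A}"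
  define Q where "Q = {A \<in> traces V (insert y S). y \<in> A}"
  define Q' where "Q' = (\<lambda>A. A - {y}) ` Q"
  have fin: "finite (traces V (insert y S))"
    using assms(1) by (simp add: finite_traces)
  have finPQ: "finite P" "finite Q" "finite Q'"
    unfolding P_def Q_def Q'_def using fin by auto
  have "card (traces V (insert y S)) = card (P \<union> Q)"
    by (rule arg_cong[where f = card]) (auto simp: P_def Q_def)
  also have "\<dots> = card P + card Q"
    by (rule card_Un_disjoint) (use finPQ in \<open>auto simp: P_def Q_def\<close>)
  also have "card Q = card Q'"
    unfolding Q'_def
    by (rule card_image [symmetric]) (metis (mono_tags, lifting) Q_def inj_onI insert_Diff mem_Collect_eq)
  also have "card P + card Q' = card (P \<union> Q') + card (P \<inter> Q')"
    by (rule card_Un_Int) (use finPQ in auto)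
  also have "\<dots> \<le> card (traces V S) + card (traces (V \<inter> {a. a \<bullet> y = 0}) S)"
  proof (rule add_mono)
    have "P \<subseteq> traces V S"
    proof
      fix A assume "A \<in> P"
      then obtain a where a: "A = {z \<in> insert y S. a \<bullet> z < 0}" "a \<in> V"
          "\<forall>z\<in>insert y S. a \<bullet> z \<noteq> 0" "y \<notin> A"
        by (auto simp: P_def traces_def)
      then have "A = {z \<in> S. a \<bullet> z < 0}" by auto
      then show "A \<in> traces V S" using a by (auto simp: traces_def)
    qed
    moreover have "Q' \<subseteq> traces V S"
    proof
      fix A assume "A \<in> Q'"
      then obtain a where a: "A = {z \<in> insert y S. a \<bullet> z < 0} - {y}" "a \<in> V"
          "\<forall>z\<in>insert y S. a \<bullet> z \<noteq> 0"
        by (auto simp: Q'_def Q_def traces_def)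
      then have "A = {z \<in> S. a \<bullet> z < 0}" using assms(2) by auto
      then show "A \<in> traces V S" using a by (auto simp: traces_def)
    qed
    ultimately show "card (P \<union> Q') \<le> card (traces V S)"
      using assms(1) by (intro card_mono finite_traces) auto
    have "P \<inter> Q' \<subseteq> traces (V \<inter> {a. a \<bullet> y = 0}) S"
    proof
      fix A assume A: "A \<in> P \<inter> Q'"
      then obtain a where a: "A = {z \<in> insert y S. a \<bullet> z < 0}" "a \<in> V"
          "\<forall>z\<in>insert y S. a \<bullet> z \<noteq> 0" "y \<notin> A"
        by (auto simp: P_def traces_def)
      from A obtain b where b: "A = {z \<in> insert y S. b \<bullet> z < 0} - {y}" "b \<in> V"
          "\<forall>z\<in>insert y S. b \<bullet> z \<noteq> 0" "b \<bullet> y < 0"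
        by (auto simp: Q'_def Q_def traces_def)
      have ay: "a \<bullet> y > 0" using a by force
      define c where "c = (a \<bullet> y) *\<^sub>R b - (b \<bullet> y) *\<^sub>R a"
      have cV: "c \<in> V" unfolding c_def
        using a(2) b(2) assms(3) by (intro subspace_diff subspace_scale) auto
      have cy: "c \<bullet> y = 0" by (simp add: c_def inner_diff_left)
      have c_inner: "c \<bullet> z = (a \<bullet> y) * (b \<bullet> z) + (- (b \<bullet> y)) * (a \<bullet> z)" for z
        by (simp add: c_def inner_diff_left)
      have same: "a \<bullet> z < 0 \<longleftrightarrow> b \<bullet> z < 0" if "z \<in> S" for z
        using that a(1) b(1) assms(2) by blast
      have neg: "c \<bullet> z < 0" if "z \<in> S" "a \<bullet> z < 0" for z
        unfolding c_inner using that same[of z] ay b(4)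
        by (intro add_neg_neg mult_pos_neg) auto
      have pos: "c \<bullet> z > 0" if "z \<in> S" "\<not> a \<bullet> z < 0" for z
      proof -
        have "a \<bullet> z > 0" "b \<bullet> z > 0"
          using that same[of z] a(3) b(3) by (force simp: not_less less_le)+
        then show ?thesis
          unfolding c_inner using ay b(4) by (intro add_pos_pos mult_pos_pos) auto
      qed
      have "A = {z \<in> S. c \<bullet> z < 0}"
        using a(1,4) neg pos by fastforce
      moreover have "\<forall>z\<in>S. c \<bullet> z \<noteq> 0"
        using neg pos by fastforce
      ultimately show "A \<in> traces (V \<inter> {a. a \<bullet> y = 0}) S"
        using cV cy by (auto simp: traces_def)
    qed
    then show "card (P \<inter> Q') \<le> card (traces (V \<inter> {a. a \<bullet> y = 0}) S)"
      using assms(1) by (intro card_mono finite_traces)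
  qed
  finally show ?thesis .
qed

text \<open>
  The number of points goes up by one in each step of the induction, while the restriction to a
  hyperplane lowers the dimension:
  \<open>2 * n ^ (d - 1) + 2 * n ^ (d - 2) \<le> 2 * (n + 1) ^ (d - 1)\<close> for \<open>d \<ge> 2\<close>. When \<open>d = 1\<close>, the
  restriction has no traces, since its only normal \<open>0\<close> is not generic.
\<close>

lemma card_traces_le:
  fixes V S :: "'a::euclidean_space set"
  assumes "finite S" "S \<noteq> {}" "subspace V"
  shows "card (traces V S) \<le> 2 * card S ^ (dim V - 1)"
  using assms
proof (induction S arbitrary: V rule: finite_ne_induct)
  case (singleton y)
  have "card (traces V {y}) \<le> card (Pow {y})"
    by (intro card_mono traces_subset_Pow) auto
  then show ?case by (simp add: card_Pow)
next
  case (insert y S)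
  define W where "W = V \<inter> {a. a \<bullet> y = 0}"
  have n: "card S \<ge> 1"
    using insert.hyps by (simp add: Suc_le_eq card_gt_0_iff)
  have W: "subspace W"
    unfolding W_def
    by (intro subspace_inter insert.prems) (auto simp: subspace_def inner_add_left)
  have step: "card (traces V (insert y S)) \<le> card (traces V S) + card (traces W S)"
    unfolding W_def using insert by (intro card_traces_insert_le) auto
  show ?case
  proof (cases "traces V (insert y S) = {}")
    case False
    then obtain a where "a \<in> V" "a \<bullet> y \<noteq> 0"
      by (auto simp: traces_def)
    then have "W \<subset> V" by (auto simp: W_def)
    then have dim: "dim W < dim V"
      using W insert.prems by (intro dim_psubset) (simp add: span_eq_iff[THEN iffD2])
    have IH_V: "card (traces V S) \<le> 2 * card S ^ (dim V - 1)"
      by (rule insert.IH[OF insert.prems])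
    show ?thesis
    proof (cases "dim W = 0")
      case True
      then have "card (traces V (insert y S)) \<le> 2 * card S ^ (dim V - 1)"
        using step IH_V traces_dim_0[OF True insert.hyps(2)] by simp
      also have "\<dots> \<le> 2 * card (insert y S) ^ (dim V - 1)"
        using insert.hyps by (intro mult_left_mono power_mono) auto
      finally show ?thesis .
    next
      case False
      then obtain k where k: "dim V = Suc (Suc k)" "dim W - 1 \<le> k"
        using dim that[of "dim V - 2"] by linarith
      have "card (traces W S) \<le> 2 * card S ^ (dim W - 1)"
        by (rule insert.IH[OF W])
      also have "\<dots> \<le> 2 * card S ^ k"
        using k n by (intro mult_left_mono power_increasing) auto
      finally have "card (traces V (insert y S)) \<le> 2 * card S ^ Suc k + 2 * card S ^ k"
        using step IH_V k by simp
      also have "\<dots> = 2 * (card S ^ k * Suc (card S))"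
        by (simp add: algebra_simps)
      also have "\<dots> \<le> 2 * (Suc (card S) ^ k * Suc (card S))"
        by (intro mult_left_mono mult_right_mono power_mono) auto
      also have "\<dots> = 2 * card (insert y S) ^ (dim V - 1)"
        using insert.hyps k by (simp add: algebra_simps)
      finally show ?thesis .
    qed
  qed simp
qed

text \<open>
  The functionals that keep the points outside the given half-space outside form an open set, and
  the non-generic ones form a null set. A half-space with \<open>b > 0\<close> contains the parallel one with
  \<open>b = 0\<close>, so only the latter has to be perturbed.
\<close>

lemma halfspace_contains_trace:
  fixes S :: "'a::euclidean_space set"
  assumes "finite S" "0 \<notin> S" "closed_halfspace H" "0 \<in> H"
  obtains T where "T \<in> traces UNIV S" "T \<subseteq> H"
proof -
  from assms obtain a b where H: "H = {y. a \<bullet> y \<le> b}" "b \<ge> 0"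
    by (auto simp: closed_halfspace_def)
  define U where "U = (\<Inter>y\<in>{y\<in>S. a \<bullet> y > 0}. {a'. y \<bullet> a' > 0})"
  define Z where "Z = (\<Union>y\<in>S. {a'. y \<bullet> a' = 0})"
  have "open U" unfolding U_def
    using assms(1) by (intro open_INT ballI open_halfspace_gt) auto
  moreover have "a \<in> U" by (auto simp: U_def inner_commute)
  ultimately have "\<not> negligible U"
    using open_not_negligible by blast
  moreover have "negligible Z" unfolding Z_def
    using assms by (intro negligible_Union) (auto intro!: negligible_hyperplane)
  ultimately obtain a' where a': "a' \<in> U" "a' \<notin> Z"
    using negligible_subset by blast
  have "{y \<in> S. a' \<bullet> y < 0} \<in> traces UNIV S"
    using a'(2) by (auto simp: traces_def Z_def inner_commute)
  moreover have "{y \<in> S. a' \<bullet> y < 0} \<subseteq> H"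
    using a'(1) H by (force simp: U_def inner_commute not_le)
  ultimately show ?thesis by (rule that)
qed

text \<open>
  Otherwise the normal of the half-space would be positive on all of \<open>C\<close>, hence on its convex hull.
\<close>

lemma trace_meets_if_0_in_convex_hull:
  assumes "T \<in> traces V S" "C \<subseteq> insert 0 S" "0 \<in> convex hull C"
  shows "C \<inter> insert 0 T \<noteq> {}"
proof
  assume disj: "C \<inter> insert 0 T = {}"
  from assms obtain a where a: "T = {y \<in> S. a \<bullet> y < 0}" "\<forall>y\<in>S. a \<bullet> y \<noteq> 0"
    by (auto simp: traces_def)
  have "C \<subseteq> {y. a \<bullet> y > 0}"
    using disj a assms(2) by (force simp: not_less less_le)
  then have "convex hull C \<subseteq> {y. a \<bullet> y > 0}"
    by (intro hull_minimal convex_halfspace_gt)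
  then show False using assms(3) by auto
qed

lemma depth_attained:
  fixes p :: "'a::euclidean_space"
  assumes "finite I"
  obtains H where "closed_halfspace H" "p \<in> H" "depth I x p = card {i \<in> I. x i \<in> H}"
proof -
  let ?D = "{card {i \<in> I. x i \<in> H} | H. closed_halfspace H \<and> p \<in> H}"
  have "?D \<subseteq> {..card I}"
    using assms by (auto intro: card_mono)
  then have "finite ?D" by (rule finite_subset) simp
  moreover have "?D \<noteq> {}"
  proof -
    obtain e :: 'a where "e \<in> Basis" using nonempty_Basis by blast
    then have "closed_halfspace {y. e \<bullet> y \<le> e \<bullet> p}"
      unfolding closed_halfspace_def using nonzero_Basis by blast
    then show ?thesis by blast
  qed
  ultimately have "Min ?D \<in> ?D" by (rule Min_in)
  then show ?thesis using that by (auto simp: depth_def)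
qed

section \<open>A random colourful choice\<close>

text \<open>
  The indicators of the events \<open>P i (c i)\<close> are independent with mean at least \<open>1 / card A\<close>, so
  this is Hoeffding's inequality for their sum.
\<close>

lemma prob_few_hits_le:
  fixes I :: "'i set" and A :: "'b set" and P :: "'i \<Rightarrow> 'b \<Rightarrow> bool" and t :: real
  assumes "finite I" "I \<noteq> {}" "finite A" "\<And>i. i \<in> I \<Longrightarrow> \<exists>j\<in>A. P i j" "t \<ge> 0"
  shows "measure_pmf.prob (Pi_pmf I dflt (\<lambda>_. pmf_of_set A))
      {c. real (card {i \<in> I. P i (c i)}) \<le> card I / card A - t} \<le> exp (- 2 * t\<^sup>2 / card I)"
proof -
  have A: "A \<noteq> {}" using assms(2,4) by blast
  define p where "p = Pi_pmf I dflt (\<lambda>_. pmf_of_set A)"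
  define X :: "'i \<Rightarrow> ('i \<Rightarrow> 'b) \<Rightarrow> real" where "X = (\<lambda>i c. indicator {j. P i j} (c i))"
  have "prob_space.indep_vars (measure_pmf p) (\<lambda>_. borel)
          (\<lambda>i. (indicator {j. P i j} :: 'b \<Rightarrow> real) \<circ> (\<lambda>c. c i)) I"
    unfolding p_def
    by (rule prob_space.indep_vars_compose[OF prob_space_measure_pmf
          indep_vars_Pi_pmf[OF assms(1)]]) simp
  then have indep: "prob_space.indep_vars (measure_pmf p) (\<lambda>_. borel) X I"
    by (simp add: X_def o_def)
  define \<mu> where "\<mu> = (\<Sum>i\<in>I. measure_pmf.expectation p (X i))"
  interpret Hoeffding_ineq "measure_pmf p" I X "\<lambda>_. 0" "\<lambda>_. 1" \<mu>
    by unfold_locales (use assms(1) indep in \<open>auto simp: X_def \<mu>_def\<close>)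
  have mean: "measure_pmf.expectation p (X i) \<ge> 1 / card A" if "i \<in> I" for i
  proof -
    have "measure_pmf.expectation p (X i)
        = measure_pmf.expectation (map_pmf (\<lambda>c. c i) p) (indicator {j. P i j})"
      by (simp only: X_def integral_map_pmf)
    also have "map_pmf (\<lambda>c. c i) p = pmf_of_set A"
      unfolding p_def using assms(1) that by (simp add: Pi_pmf_component)
    also have "measure_pmf.expectation (pmf_of_set A) (indicator {j. P i j})
        = card (A \<inter> {j. P i j}) / card A"
      using A assms(3) by (simp add: measure_pmf_of_set)
    also have "card (A \<inter> {j. P i j}) \<ge> 1"
      using assms(3) assms(4)[OF that] by (auto simp: Suc_le_eq card_gt_0_iff)
    then have "real (card (A \<inter> {j. P i j})) / card A \<ge> 1 / card A"
      by (intro divide_right_mono) auto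
    finally show ?thesis by simp
  qed
  have "card I / card A = (\<Sum>i\<in>I. 1 / card A)" by simp
  also have "\<dots> \<le> \<mu>" unfolding \<mu>_def by (intro sum_mono mean)
  finally have \<mu>: "card I / card A \<le> \<mu>" .
  have sum_X: "(\<Sum>i\<in>I. X i c) = card {i \<in> I. P i (c i)}" for c
    unfolding X_def using assms(1) by (simp add: indicator_def sum.If_cases Int_def)
  have "measure_pmf.prob p {c. real (card {i \<in> I. P i (c i)}) \<le> card I / card A - t}
      \<le> measure_pmf.prob p {c\<in>space (measure_pmf p). (\<Sum>i\<in>I. X i c) \<le> \<mu> - t}"
    using \<mu> by (intro measure_pmf.finite_measure_mono) (auto simp: sum_X)
  also have "\<dots> \<le> exp (- 2 * t\<^sup>2 / (\<Sum>i\<in>I. (1 - 0)\<^sup>2))"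
    using assms by (intro Hoeffding_ineq_le) (auto simp: card_gt_0_iff)
  finally show ?thesis by (simp add: p_def)
qed

text \<open>The union bound: some choice avoids the bad event of every member of \<open>\<H>\<close>.\<close>

lemma exists_choice_with_many_hits:
  fixes I :: "'i set" and A :: "'b set" and P :: "'h \<Rightarrow> 'i \<Rightarrow> 'b \<Rightarrow> bool" and t :: real
  assumes "finite I" "I \<noteq> {}" "finite A" "finite \<H>"
    and "\<And>h i. h \<in> \<H> \<Longrightarrow> i \<in> I \<Longrightarrow> \<exists>j\<in>A. P h i j"
    and "A \<noteq> {}" "t \<ge> 0" "card \<H> * exp (- 2 * t\<^sup>2 / card I) < 1"
  obtains c where "\<And>i. i \<in> I \<Longrightarrow> c i \<in> A"
    and "\<And>h. h \<in> \<H> \<Longrightarrow> real (card {i \<in> I. P h i (c i)}) > card I / card A - t"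
proof -
  define p where "p = Pi_pmf I undefined (\<lambda>_. pmf_of_set A)"
  define B where "B = (\<lambda>h. {c. real (card {i \<in> I. P h i (c i)}) \<le> card I / card A - t})"
  have "measure_pmf.prob p (\<Union>h\<in>\<H>. B h) \<le> (\<Sum>h\<in>\<H>. measure_pmf.prob p (B h))"
    using assms(4) by (intro measure_pmf.finite_measure_subadditive_finite) auto
  also have "\<dots> \<le> (\<Sum>h\<in>\<H>. exp (- 2 * t\<^sup>2 / card I))"
    unfolding p_def B_def using assms by (intro sum_mono prob_few_hits_le) auto
  also have "\<dots> < 1" using assms by simp
  finally have "measure_pmf.prob p (\<Union>h\<in>\<H>. B h) < 1" .
  then have "\<not> set_pmf p \<subseteq> (\<Union>h\<in>\<H>. B h)"
    by (metis less_irrefl measure_pmf.prob_eq_1 AE_measure_pmf_iff subsetD UNIV_I sets_measure_pmf)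
  then obtain c where "c \<in> set_pmf p" and good: "\<And>h. h \<in> \<H> \<Longrightarrow> c \<notin> B h" by blast
  moreover have "c i \<in> A" if "i \<in> I" for i
    using \<open>c \<in> set_pmf p\<close> that assms
    by (auto simp: p_def set_Pi_pmf PiE_dflt_def)
  ultimately show ?thesis
    using that[of c] by (auto simp: B_def not_le)
qed

section \<open>The depth of a colourful choice\<close>

lemma card_le_depth_0:
  fixes I :: "'i set"
  assumes "finite I" "\<And>i. i \<in> I \<Longrightarrow> x i = 0"
  shows "card I \<le> depth I x 0"
proof -
  obtain H where H: "0 \<in> H" "depth I x 0 = card {i \<in> I. x i \<in> H}"
    using depth_attained[OF assms(1)] by metis
  have "{i \<in> I. x i \<in> H} = I" using assms H by auto
  then show ?thesis using H by simp
qed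

theorem lemma2p2:
  fixes N r :: nat and F :: "nat \<Rightarrow> nat \<Rightarrow> real ^ 'd"
  assumes "N \<ge> 1" and "r \<ge> 1"
    and "\<And>i. i \<in> {1..N} \<Longrightarrow> 0 \<in> convex hull (F i ` {1..r})"
  shows "\<exists>x :: nat \<Rightarrow> real ^ 'd. (\<forall>i\<in>{1..N}. x i \<in> F i ` {1..r}) \<and>
    real (depth {1..N} x 0) \<ge>
      real N / real r - sqrt (real CARD('d) * real N * ln (real N * real r) / 2)"
proof -
  define d where "d = CARD('d)"
  define M where "M = N * r"
  define t where "t = sqrt (real d * real N * ln (real M) / 2)"
  have d: "d \<ge> 1" unfolding d_def by (simp add: Suc_le_eq)
  have M1: "M \<ge> 1" using assms by (simp add: M_def Suc_le_eq)
  have t0: "t \<ge> 0" unfolding t_def using M1 by simp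
  have t2: "t\<^sup>2 = real d * real N * ln (real M) / 2" unfolding t_def using M1 by simp
  have "\<exists>x :: nat \<Rightarrow> real ^ 'd. (\<forall>i\<in>{1..N}. x i \<in> F i ` {1..r}) \<and>
      real (depth {1..N} x 0) \<ge> real N / real r - t"
  proof -
    consider "r = 1" | "N = 1" "r = 2" | "M \<ge> 3"
    proof -
      have "r = 1 \<or> (N = 1 \<and> r = 2) \<or> M \<ge> 3"
      proof (cases "N = 1")
        case False
        then have "r \<ge> 2 \<Longrightarrow> 2 * 2 \<le> M"
          unfolding M_def using assms(1) by (intro mult_le_mono) auto
        then show ?thesis using assms(2) by linarith
      qed (use assms(2) in \<open>auto simp: M_def\<close>)
      then show thesis using that by blast
    qed
    then show ?thesis
    proof cases
      case 1
      then have F0: "F i 1 = 0" if "i \<in> {1..N}" for i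
        using assms(3)[OF that] by simp
      then have "N \<le> depth {1..N} (\<lambda>i. F i 1) 0"
        using card_le_depth_0[of "{1..N}" "\<lambda>i. F i 1"] by simp
      then show ?thesis
        using 1 t0 by (intro exI[of _ "\<lambda>i. F i 1"]) auto
    next
      case 2
      \<comment> \<open>Here \<open>N / r = 1 / 2\<close>, and \<open>ln 2 \<ge> 1 / 2\<close> gives \<open>t \<ge> 1 / 2\<close>, so nothing is left to bound.\<close>
      have "ln (2::real) \<ge> 1 - 1 / 2"
        using ln_le_minus_one[of "1 / 2 :: real"] by (simp add: ln_div)
      then have "1 / 2 * 1 \<le> ln 2 * real d"
        using d by (intro mult_mono) auto
      then have "(1 / 2)\<^sup>2 \<le> t\<^sup>2"
        unfolding t2 using 2 by (simp add: M_def power2_eq_square algebra_simps)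
      then have "1 / 2 \<le> t" using t0 by (rule power2_le_imp_le)
      then show ?thesis
        using 2 by (intro exI[of _ "\<lambda>i. F i 1"]) auto
    next
      case 3
      define S where "S = (\<Union>i\<in>{1..N}. F i ` {1..r}) - {0}"
      have finS: "finite S" unfolding S_def by simp
      have "card S \<le> card (\<Union>i\<in>{1..N}. F i ` {1..r})"
        unfolding S_def by (intro card_mono) auto
      also have "\<dots> \<le> (\<Sum>i\<in>{1..N}. card (F i ` {1..r}))"
        by (intro card_UN_le) simp
      also have "\<dots> \<le> (\<Sum>i\<in>{1..N}. r)"
        by (intro sum_mono) (metis card_image_le card_atLeastAtMost diff_Suc_1 finite_atLeastAtMost)
      finally have cardS: "card S \<le> M" by (simp add: M_def)
      have "card (traces UNIV S) < M ^ d"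
      proof (cases "S = {}")
        case True
        then have "traces UNIV S \<subseteq> {{}}" by (auto simp: traces_def)
        then have "card (traces UNIV S) \<le> card {{} :: (real ^ 'd) set}"
          by (intro card_mono) auto
        also have "\<dots> < M ^ d" using 3 d one_less_power[of M d] by simp
        finally show ?thesis .
      next
        case False
        then have "card (traces UNIV S) \<le> 2 * card S ^ (d - 1)"
          using card_traces_le[OF finS False subspace_UNIV] by (simp add: d_def)
        also have "\<dots> \<le> 2 * M ^ (d - 1)"
          using cardS by (intro mult_left_mono power_mono) auto
        also have "\<dots> < M * M ^ (d - 1)" using 3 by simp
        also have "\<dots> = M ^ d" using d by (simp add: power_eq_if)
        finally show ?thesis .
      qed
      then have few: "real (card (traces UNIV S)) < real M ^ d"
        by (metis of_nat_less_iff of_nat_power)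
      have "- 2 * t\<^sup>2 / card {1..N} = - (real d * ln (real M))"
        unfolding t2 using assms(1) by simp
      then have exp: "exp (- 2 * t\<^sup>2 / card {1..N}) = 1 / real M ^ d"
        using M1 by (simp add: exp_minus exp_of_nat_mult inverse_eq_divide)
      have union: "card (traces UNIV S) * exp (- 2 * t\<^sup>2 / card {1..N}) < 1"
        unfolding exp using few M1 by simp
      have meets: "\<exists>j\<in>{1..r}. F i j \<in> insert 0 T"
        if "T \<in> traces UNIV S" "i \<in> {1..N}" for T i
      proof -
        have "F i ` {1..r} \<subseteq> insert 0 S"
          unfolding S_def using that(2) by blast
        then have "F i ` {1..r} \<inter> insert 0 T \<noteq> {}"
          using trace_meets_if_0_in_convex_hull[OF that(1)] assms(3)[OF that(2)] by blast
        then show ?thesis by blast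
      qed
      obtain c where c: "\<And>i. i \<in> {1..N} \<Longrightarrow> c i \<in> {1..r}"
        and good: "\<And>T. T \<in> traces UNIV S \<Longrightarrow>
          real (card {i \<in> {1..N}. F i (c i) \<in> insert 0 T}) > card {1..N} / card {1..r} - t"
      proof (rule exists_choice_with_many_hits[of "{1..N}" "{1..r}" "traces UNIV S"
            "\<lambda>T i j. F i j \<in> insert 0 T" t])
        show "\<exists>j\<in>{1..r}. F i j \<in> insert 0 T" if "T \<in> traces UNIV S" "i \<in> {1..N}" for T i
          by (fact meets[OF that])
      qed (use assms(1,2) finite_traces[OF finS] t0 union that in \<open>auto simp del: insert_iff\<close>)
      define x where "x = (\<lambda>i. F i (c i))"
      obtain H where H: "closed_halfspace H" "0 \<in> H"
          "depth {1..N} x 0 = card {i \<in> {1..N}. x i \<in> H}"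
        using depth_attained[of "{1..N}" 0 x] by auto
      obtain T where T: "T \<in> traces UNIV S" "T \<subseteq> H"
        using halfspace_contains_trace[OF finS _ H(1,2)] unfolding S_def by blast
      have "card {i \<in> {1..N}. x i \<in> insert 0 T} \<le> depth {1..N} x 0"
        unfolding H(3) using T(2) H(2) by (intro card_mono) auto
      then have "real N / real r - t \<le> real (depth {1..N} x 0)"
        using good[OF T(1)] by (simp add: x_def)
      then show ?thesis
        using c by (intro exI[of _ x]) (auto simp: x_def)
    qed
  qed
  then show ?thesis by (simp add: t_def d_def M_def)
qed

end
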